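(* Let $G$ be a finite group and let $p$ be a prime. Then $G$ is the (internal) direct product of a $p$-group and a $p'$-group if and only if $$|\mathcal{S}_{p'}(G)|=|G|_{p'}\cdot|\mathbf{Z}(G)|_{p}.$$
   Context: $\mathbf{Z}(G)$ denotes the centre of $G$. For a positive integer $n$ and a prime $p$, write $n=n_p\cdot n_{p'}$, where $n_p$ is the largest power of $p$ dividing $n$ and $n_{p'}$ is coprime to $p$. A $p'$-group is a finite group of order coprime to $p$; the trivial group counts both as a $p$-group and as a $p'$-group. For a finite group $G$, $\mathcal{S}_{p'}(G)$ denotes the union of those conjugacy classes of $G$ whose cardinality is coprime to $p$, i.e. $\mathcal{S}_{p'}(G)=\{g\in G: p\nmid |G:\mathbf{C}_G(g)|\}$, where $\mathbf{C}_G(g)$ is the centralizer of $g$ in $G$. *)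

theory Defs
  imports "HOL-Algebra.Group_Action" "HOL-Algebra.Elementary_Groups"
    "HOL-Computational_Algebra.Primes"
begin

definition centralizer :: "('a, 'b) monoid_scheme \<Rightarrow> 'a \<Rightarrow> 'a set" where
  "centralizer G g = {x \<in> carrier G. x \<otimes>\<^bsub>G\<^esub> g = g \<otimes>\<^bsub>G\<^esub> x}"

definition centre :: "('a, 'b) monoid_scheme \<Rightarrow> 'a set" where
  "centre G = {z \<in> carrier G. \<forall>g\<in>carrier G. z \<otimes>\<^bsub>G\<^esub> g = g \<otimes>\<^bsub>G\<^esub> z}"

definition conjugacy_class :: "('a, 'b) monoid_scheme \<Rightarrow> 'a \<Rightarrow> 'a set" where
  "conjugacy_class G g = {x \<otimes>\<^bsub>G\<^esub> g \<otimes>\<^bsub>G\<^esub> inv\<^bsub>G\<^esub> x | x. x \<in> carrier G}"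

definition p_part :: "nat \<Rightarrow> nat \<Rightarrow> nat" where
  "p_part p n = p ^ multiplicity p n"

definition p'_part :: "nat \<Rightarrow> nat \<Rightarrow> nat" where
  "p'_part p n = n div p_part p n"

definition p_group :: "nat \<Rightarrow> ('a, 'b) monoid_scheme \<Rightarrow> bool" where
  "p_group p G \<longleftrightarrow> group G \<and> finite (carrier G) \<and> (\<exists>k. order G = p ^ k)"

definition p'_group :: "nat \<Rightarrow> ('a, 'b) monoid_scheme \<Rightarrow> bool" where
  "p'_group p G \<longleftrightarrow> group G \<and> finite (carrier G) \<and> coprime (order G) p"

definition internal_direct_product ::
    "('a, 'b) monoid_scheme \<Rightarrow> 'a set \<Rightarrow> 'a set \<Rightarrow> bool" where
  "internal_direct_product G H K \<longleftrightarrow>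
     H \<lhd> G \<and> K \<lhd> G \<and> H \<inter> K = {\<one>\<^bsub>G\<^esub>} \<and> H <#>\<^bsub>G\<^esub> K = carrier G"

definition S_p' :: "nat \<Rightarrow> ('a, 'b) monoid_scheme \<Rightarrow> 'a set" where
  "S_p' p G =
     \<Union>{C. \<exists>g\<in>carrier G. C = conjugacy_class G g \<and> coprime (card C) p}"

lemma p_part_mult_p'_part: "p_part p n * p'_part p n = n"
  by (simp add: p_part_def p'_part_def multiplicity_dvd)

lemma coprime_p'_part:
  assumes "prime p" "n > 0"
  shows "coprime (p'_part p n) p"
proof -
  have "\<not> is_unit p"
    using assms by auto
  hence "\<not> p dvd p'_part p n"
    using multiplicity_decompose[of n p] assms
    by (simp add: p'_part_def p_part_def)
  with assms show ?thesis
    by (simp add: coprime_commute prime_imp_coprime)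
qed

lemma (in group) card_conjugacy_class:
  assumes "g \<in> carrier G"
  shows "card (conjugacy_class G g) = card (rcosets (centralizer G g))"
proof -
  let ?phi = "\<lambda>x. \<lambda>h\<in>carrier G. x \<otimes> h \<otimes> inv x"
  interpret group_action G "carrier G" ?phi
    by (rule action_by_conjugation)
  have "conjugacy_class G g = orbit G ?phi g"
    using assms by (simp add: conjugacy_class_def orbit_def)
  moreover have "x \<otimes> g \<otimes> inv x = g \<longleftrightarrow> x \<otimes> g = g \<otimes> x" if "x \<in> carrier G" for x
    using that assms by (simp add: inv_solve_right')
  hence "centralizer G g = stabilizer G ?phi g"
    using assms by (auto simp: centralizer_def stabilizer_def)
  ultimately show ?thesis
    using bij_betw_same_card[OF orbit_stab_fun_is_bij[OF assms]] by simp
qed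

lemma (in group) S_p'_eq:
  assumes "prime p"
  shows "S_p' p G = {g \<in> carrier G. \<not> p dvd card (rcosets (centralizer G g))}"
proof -
  have cop: "coprime n p \<longleftrightarrow> \<not> p dvd n" for n :: nat
    using assms prime_imp_coprime[of p n] coprime_absorb_left[of p n] not_prime_unit[of p]
    unfolding coprime_commute[of n p] by blast
  have refl: "g \<in> conjugacy_class G g" if "g \<in> carrier G" for g
    unfolding conjugacy_class_def using that by (auto intro!: exI[of _ \<one>])
  have carr: "h \<in> carrier G" if hyp: "g \<in> carrier G" "h \<in> conjugacy_class G g" for g h
    using hyp by (auto simp: conjugacy_class_def)
  have sub: "conjugacy_class G h \<subseteq> conjugacy_class G g"
    if hyp: "g \<in> carrier G" "h \<in> conjugacy_class G g" for g h
  proof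
    fix k assume "k \<in> conjugacy_class G h"
    then obtain x y where xy: "x \<in> carrier G" "y \<in> carrier G"
      "h = x \<otimes> g \<otimes> inv x" "k = y \<otimes> h \<otimes> inv y"
      using hyp(2) by (auto simp: conjugacy_class_def)
    hence "k = (y \<otimes> x) \<otimes> g \<otimes> inv (y \<otimes> x)"
      using hyp(1) by (simp add: inv_mult_group m_assoc)
    with xy show "k \<in> conjugacy_class G g"
      unfolding conjugacy_class_def by blast
  qed
  have sym: "g \<in> conjugacy_class G h"
    if hyp: "g \<in> carrier G" "h \<in> conjugacy_class G g" for g h
  proof -
    obtain x where x: "x \<in> carrier G" "h = x \<otimes> g \<otimes> inv x"
      using hyp(2) by (auto simp: conjugacy_class_def)
    hence "inv x \<otimes> h \<otimes> inv (inv x) = (inv x \<otimes> x) \<otimes> g \<otimes> (inv x \<otimes> x)"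
      using hyp(1) by (simp only: m_assoc inv_closed m_closed inv_inv)
    hence "g = inv x \<otimes> h \<otimes> inv (inv x)"
      using hyp(1) x(1) by simp
    with x show ?thesis
      unfolding conjugacy_class_def by blast
  qed
  have eq: "conjugacy_class G h = conjugacy_class G g"
    if hyp: "g \<in> carrier G" "h \<in> conjugacy_class G g" for g h
    using sub[OF hyp] sub[OF carr[OF hyp] sym[OF hyp]] by (rule equalityI)
  have "S_p' p G = {g \<in> carrier G. coprime (card (conjugacy_class G g)) p}"
  proof (intro Set.set_eqI iffI)
    fix h assume "h \<in> S_p' p G"
    then obtain g where g: "g \<in> carrier G" "h \<in> conjugacy_class G g"
      "coprime (card (conjugacy_class G g)) p"
      by (auto simp: S_p'_def)
    thus "h \<in> {g \<in> carrier G. coprime (card (conjugacy_class G g)) p}"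
      using carr[OF g(1,2)] eq[OF g(1,2)] by simp
  next
    fix h assume "h \<in> {g \<in> carrier G. coprime (card (conjugacy_class G g)) p}"
    thus "h \<in> S_p' p G"
      using refl[of h] unfolding S_p'_def by blast
  qed
  thus ?thesis
    by (simp only: cop card_conjugacy_class cong: conj_cong)
qed

end

theory Submission
  imports Defs "HOL-Algebra.Multiplicative_Group" "HOL-Algebra.Sylow"
begin

text \<open>
  Let \<open>P\<close> be a Sylow \<open>p\<close>-subgroup of \<open>G\<close>, let \<open>D\<close> be its centralizer and let \<open>q\<close> be the
  \<open>p'\<close>-part of the order of \<open>G\<close>. Both sides of the equivalence turn out to say that \<open>G = P D\<close>.

  Every element of \<open>S_p'\<close> has a conjugate in \<open>D\<close>, because \<open>P\<close> acts by conjugation on the class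
  of the element, and an action of a \<open>p\<close>-group on a finite set of size prime to \<open>p\<close> has a fixed
  point. So \<open>S_p'\<close> is covered by the conjugates of \<open>D\<close>. Since \<open>P D\<close>
  normalizes \<open>D\<close>, there are at most \<open>m = |G : P D|\<close> of them, all containing the identity, and
  \<open>m |D| = q |P \<inter> D|\<close>. This gives \<open>|S_p'| \<le> q |P \<inter> D| - (m - 1)\<close>
  (lemmas \<open>card_S_p'_le\<close> and \<open>index_PD\<close>).

  The bound involves \<open>P \<inter> D\<close>, which is the centre of \<open>P\<close>, whereas the theorem involves the
  \<open>p\<close>-part of the centre of \<open>G\<close>, which is \<open>|Z|\<close> for \<open>Z = centre G \<inter> P\<close>. The two are linked by
  a congruence: \<open>P\<close> acts by conjugation on the cosets of \<open>Z\<close> in \<open>S_p'\<close>, and the fixed cosets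
  are those of the elements of \<open>D\<close>, so \<open>|S_p'| / |Z|\<close> and \<open>|D| / |Z|\<close> agree modulo \<open>p\<close>. If
  \<open>|S_p'| = q |Z|\<close>, then the first number is prime to \<open>p\<close>, while \<open>|P \<inter> D| / |Z|\<close> is a power of
  \<open>p\<close> that divides the second one. Hence \<open>P \<inter> D = Z\<close> (lemma \<open>centre_of_P_central\<close>), and now
  the bound forces \<open>m = 1\<close>, that is, \<open>G = P D\<close>. Conversely, \<open>G = P D\<close> makes \<open>D\<close> normal
  and \<open>P \<inter> D\<close> central, so that \<open>S_p' = D\<close> has \<open>q |Z|\<close> elements.

  It remains to compare \<open>G = P D\<close> with the decomposition. A \<open>p'\<close>-group that complements \<open>P\<close> in
  a direct product lies in \<open>D\<close>. In the other direction, if \<open>G = P D\<close>, then \<open>P \<inter> D\<close> is a central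
  subgroup of \<open>D\<close> whose index \<open>q\<close> is prime to its order. The transfer homomorphism from \<open>D\<close> to
  \<open>P \<inter> D\<close> restricts to the \<open>q\<close>-th power map there, so its kernel is a complement
  (lemma \<open>central_coprime_index_complement\<close>), and this kernel is the \<open>p'\<close>-factor of \<open>G\<close>.
\<close>

section \<open>Counting with subgroups and with actions of \<open>p\<close>-groups\<close>

lemma (in group) subgroup_finite:
  assumes "finite (carrier G)" "subgroup H G"
  shows "finite H"
  using assms finite_subset subgroup.subset by blast

lemma (in group) card_subgroup_dvd:
  assumes "finite (carrier G)" "subgroup H G" "subgroup K G" "H \<subseteq> K"
  shows "card H dvd card K"
proof -
  have "subgroup H (G\<lparr>carrier := K\<rparr>)"
    by (rule subgroup_incl) (use assms in auto)
  from group.lagrange[OF subgroup_imp_group[OF assms(3)] this] show ?thesis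
    by (simp add: order_def) (metis dvd_triv_right)
qed

lemma (in group) subgroup_set_mult_commuting:
  assumes H: "subgroup H G" and K: "subgroup K G"
    and comm: "\<And>h k. h \<in> H \<Longrightarrow> k \<in> K \<Longrightarrow> h \<otimes> k = k \<otimes> h"
  shows "subgroup (H <#> K) G"
proof (rule subgroupI)
  interpret H: subgroup H G by (rule H)
  interpret K: subgroup K G by (rule K)
  show "H <#> K \<subseteq> carrier G"
    by (auto simp: set_mult_def)
  show "H <#> K \<noteq> {}"
    using H.one_closed K.one_closed unfolding set_mult_def by blast
  show "inv a \<in> H <#> K" if a: "a \<in> H <#> K" for a
  proof -
    obtain h k where hk: "h \<in> H" "k \<in> K" "a = h \<otimes> k"
      using a by (auto simp: set_mult_def)
    hence "inv a = inv h \<otimes> inv k"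
      using comm[of h k] by (simp add: inv_mult_group)
    thus ?thesis
      using hk H.m_inv_closed K.m_inv_closed unfolding set_mult_def by blast
  qed
  show "a \<otimes> b \<in> H <#> K" if ab: "a \<in> H <#> K" "b \<in> H <#> K" for a b
  proof -
    obtain h k h' k' where hk: "h \<in> H" "k \<in> K" "a = h \<otimes> k" "h' \<in> H" "k' \<in> K" "b = h' \<otimes> k'"
      using ab unfolding set_mult_def by blast
    hence "a \<otimes> b = h \<otimes> (k \<otimes> h') \<otimes> k'"
      by (simp add: m_assoc)
    also have "\<dots> = (h \<otimes> h') \<otimes> (k \<otimes> k')"
      using hk comm[of h' k] by (simp add: m_assoc flip: comm)
    finally show ?thesis
      using hk H.m_closed K.m_closed unfolding set_mult_def by blast
  qed
qed

text \<open>
  The fibre of the multiplication map over \<open>h \<otimes> k\<close> consists of the pairs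
  \<open>(h \<otimes> z, inv z \<otimes> k)\<close> with \<open>z\<close> in the intersection.
\<close>
lemma (in group) card_set_mult:
  assumes fin: "finite (carrier G)" and H: "subgroup H G" and K: "subgroup K G"
  shows "card (H <#> K) * card (H \<inter> K) = card H * card K"
proof -
  interpret H: subgroup H G by (rule H)
  interpret K: subgroup K G by (rule K)
  let ?m = "\<lambda>(h, k). h \<otimes> k"
  have finHK: "finite (H \<times> K)"
    using subgroup_finite[OF fin] H K by simp
  have img: "H <#> K = ?m ` (H \<times> K)"
    by (auto simp: set_mult_def)
  have fibre: "card {y \<in> H \<times> K. ?m y = x} = card (H \<inter> K)" if x: "x \<in> H <#> K" for x
  proof -
    obtain h k where hk: "h \<in> H" "k \<in> K" "x = h \<otimes> k"
      using x by (auto simp: set_mult_def)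
    have "bij_betw (\<lambda>z. (h \<otimes> z, inv z \<otimes> k)) (H \<inter> K) {y \<in> H \<times> K. ?m y = x}"
    proof (rule bij_betw_byWitness[where f' = "\<lambda>(a, b). inv h \<otimes> a"])
      show "\<forall>z\<in>H \<inter> K. (\<lambda>(a, b). inv h \<otimes> a) (h \<otimes> z, inv z \<otimes> k) = z"
        using hk by (simp flip: m_assoc)
    next
      have inverse: "(h \<otimes> (inv h \<otimes> a), inv (inv h \<otimes> a) \<otimes> k) = (a, b)"
        if ab: "a \<in> H" "b \<in> K" "a \<otimes> b = x" for a b
      proof -
        have "inv (inv h \<otimes> a) \<otimes> k = inv a \<otimes> (h \<otimes> k)"
          using ab(1,2) hk(1,2) by (simp add: inv_mult_group m_assoc)
        also have "\<dots> = inv a \<otimes> (a \<otimes> b)"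
          by (simp only: ab(3) hk(3))
        also have "\<dots> = b"
          using ab(1,2) by (simp flip: m_assoc)
        finally show ?thesis
          using ab(1,2) hk(1,2) by (simp flip: m_assoc)
      qed
      show "\<forall>y\<in>{y \<in> H \<times> K. ?m y = x}.
          (h \<otimes> (\<lambda>(a, b). inv h \<otimes> a) y, inv ((\<lambda>(a, b). inv h \<otimes> a) y) \<otimes> k) = y"
      proof
        fix y assume "y \<in> {y \<in> H \<times> K. ?m y = x}"
        moreover obtain a b where "y = (a, b)" by (cases y)
        ultimately have "y = (a, b)" "a \<in> H" "b \<in> K" "a \<otimes> b = x" by auto
        with inverse[of a b] show
          "(h \<otimes> (\<lambda>(a, b). inv h \<otimes> a) y, inv ((\<lambda>(a, b). inv h \<otimes> a) y) \<otimes> k) = y"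
          by (simp only: prod.case)
      qed
    next
      have "h \<otimes> z \<otimes> (inv z \<otimes> k) = x" if z: "z \<in> H" "z \<in> K" for z
      proof -
        have "z \<otimes> (inv z \<otimes> k) = k"
          using z hk(1,2) by (simp flip: m_assoc)
        thus ?thesis
          using z hk(1,2) by (simp add: m_assoc hk(3))
      qed
      thus "(\<lambda>z. (h \<otimes> z, inv z \<otimes> k)) ` (H \<inter> K) \<subseteq> {y \<in> H \<times> K. ?m y = x}"
        using hk by auto
    next
      have mem: "inv h \<otimes> a \<in> H \<inter> K" if ab: "a \<in> H" "b \<in> K" "a \<otimes> b = x" for a b
      proof -
        have "inv h \<otimes> a = inv h \<otimes> (a \<otimes> b) \<otimes> inv b"
          using ab(1,2) hk(1) by (simp add: m_assoc)
        also have "\<dots> = inv h \<otimes> (h \<otimes> k) \<otimes> inv b"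
          by (simp only: ab(3) hk(3))
        also have "\<dots> = k \<otimes> inv b"
          using ab(1,2) hk(1,2) by (simp flip: m_assoc)
        finally have "inv h \<otimes> a \<in> K"
          using ab hk by simp
        thus ?thesis
          using ab hk by simp
      qed
      show "(\<lambda>(a, b). inv h \<otimes> a) ` {y \<in> H \<times> K. ?m y = x} \<subseteq> H \<inter> K"
      proof (rule image_subsetI)
        fix y assume "y \<in> {y \<in> H \<times> K. ?m y = x}"
        moreover obtain a b where "y = (a, b)" by (cases y)
        ultimately have "y = (a, b)" "a \<in> H" "b \<in> K" "a \<otimes> b = x" by auto
        with mem[of a b] show "(\<lambda>(a, b). inv h \<otimes> a) y \<in> H \<inter> K"
          by (simp only: prod.case)
      qed
    qed
    thus ?thesis
      using bij_betw_same_card by fastforce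
  qed
  have "card H * card K = (\<Sum>y\<in>H \<times> K. 1)"
    by (simp add: card_cartesian_product)
  also have "\<dots> = (\<Sum>x\<in>?m ` (H \<times> K). \<Sum>y\<in>{y \<in> H \<times> K. ?m y = x}. 1)"
    by (rule sum.image_gen[OF finHK])
  also have "\<dots> = (\<Sum>x\<in>H <#> K. card (H \<inter> K))"
    unfolding img[symmetric] using fibre by (intro sum.cong) auto
  finally show ?thesis by simp
qed

lemma (in group) card_cosets_of_invariant_set:
  assumes fin: "finite (carrier G)" and N: "subgroup N G" and A: "A \<subseteq> carrier G"
    and closed: "\<And>n a. n \<in> N \<Longrightarrow> a \<in> A \<Longrightarrow> n \<otimes> a \<in> A"
  shows "card ((\<lambda>a. N #> a) ` A) * card N = card A"
proof -
  interpret N: subgroup N G by (rule N)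
  have un: "\<Union>((\<lambda>a. N #> a) ` A) = A"
    using closed rcos_self[OF _ N] A by (force simp: r_coset_def)
  have sub: "(\<lambda>a. N #> a) ` A \<subseteq> rcosets N"
    using A by (auto simp: RCOSETS_def)
  have finA: "finite A"
    using A fin finite_subset by blast
  have "card N * card ((\<lambda>a. N #> a) ` A) = card (\<Union>((\<lambda>a. N #> a) ` A))"
  proof (rule card_partition)
    show "card c = card N" if "c \<in> (\<lambda>a. N #> a) ` A" for c
      using card_rcosets_equal[of c N] sub that N.subset by auto
    show "c \<inter> d = {}" if "c \<in> (\<lambda>a. N #> a) ` A" "d \<in> (\<lambda>a. N #> a) ` A" "c \<noteq> d" for c d
      using rcos_disjoint[OF N] sub that by (auto simp: pairwise_def disjnt_def)
  qed (use finA un in auto)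
  thus ?thesis
    by (simp add: un mult.commute)
qed

text \<open>Every orbit that is not a single point has a nontrivial power of \<open>p\<close> as its size.\<close>
lemma p_group_prime_dvd_card_moved_points:
  fixes H (structure)
  assumes "group H" and ord: "order H = p ^ k" and p: "Factorial_Ring.prime p" and fin: "finite X"
    and closed: "\<And>h x. h \<in> carrier H \<Longrightarrow> x \<in> X \<Longrightarrow> act h x \<in> X"
    and one: "\<And>x. x \<in> X \<Longrightarrow> act \<one> x = x"
    and mult: "\<And>g h x. g \<in> carrier H \<Longrightarrow> h \<in> carrier H \<Longrightarrow> x \<in> X
                 \<Longrightarrow> act (g \<otimes> h) x = act g (act h x)"
  shows "p dvd card {x \<in> X. \<exists>h\<in>carrier H. act h x \<noteq> x}"
proof -
  interpret group H by (rule assms(1))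
  define \<phi> where "\<phi> = (\<lambda>h. \<lambda>x\<in>X. act h x)"
  have bij: "\<phi> h \<in> Bij X" if h: "h \<in> carrier H" for h
  proof -
    have "bij_betw (act h) X X"
      by (rule bij_betw_byWitness[where f' = "act (inv h)"])
         (use h closed one in \<open>auto simp: mult[symmetric]\<close>)
    thus ?thesis
      by (auto simp: Bij_def \<phi>_def extensional_def bij_betw_def inj_on_def)
  qed
  interpret group_action H X \<phi>
  proof (intro group_action.intro group_hom.intro group_hom_axioms.intro)
    show "group H" "group (BijGroup X)" by (rule group_axioms group_BijGroup)+
    show "\<phi> \<in> hom H (BijGroup X)"
    proof (rule homI)
      show "\<phi> h \<in> carrier (BijGroup X)" if "h \<in> carrier H" for h
        using bij[OF that] by (simp add: BijGroup_def)
      show "\<phi> (g \<otimes> h) = \<phi> g \<otimes>\<^bsub>BijGroup X\<^esub> \<phi> h"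
        if "g \<in> carrier H" "h \<in> carrier H" for g h
        using that bij closed mult
        by (auto simp: BijGroup_def \<phi>_def compose_def restrict_def)
    qed
  qed
  let ?M = "{x \<in> X. \<exists>h\<in>carrier H. act h x \<noteq> x}"
  have self: "x \<in> orbit H \<phi> x" if "x \<in> X" for x
    using orbit_refl[OF that] .
  have orbX: "orbit H \<phi> x \<subseteq> X" if "x \<in> X" for x
    using that closed by (auto simp: orbit_def \<phi>_def)
  have eq: "orbit H \<phi> y = orbit H \<phi> x" if "x \<in> X" "y \<in> orbit H \<phi> x" for x y
    using that orbX orbit_sym orbit_trans by (meson subset_antisym subset_iff)
  have M_orbit: "x \<in> ?M \<longleftrightarrow> orbit H \<phi> x \<noteq> {x}" if "x \<in> X" for x
    using that self[OF that] by (auto simp: orbit_def \<phi>_def)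
  have "\<Union>(orbit H \<phi> ` ?M) = ?M"
  proof
    show "?M \<subseteq> \<Union>(orbit H \<phi> ` ?M)"
      using self by blast
    show "\<Union>(orbit H \<phi> ` ?M) \<subseteq> ?M"
    proof
      fix y assume "y \<in> \<Union>(orbit H \<phi> ` ?M)"
      then obtain x where x: "x \<in> ?M" "y \<in> orbit H \<phi> x" by blast
      hence xX: "x \<in> X" and yX: "y \<in> X" using orbX by auto
      have "orbit H \<phi> y \<noteq> {y}"
        using eq[OF xX x(2)] M_orbit[OF xX] x(1) self[OF xX] by auto
      thus "y \<in> ?M" using M_orbit[OF yX] by blast
    qed
  qed
  moreover have "p dvd card (\<Union>(orbit H \<phi> ` ?M))"
  proof (rule dvd_partition)
    show "finite (\<Union>(orbit H \<phi> ` ?M))"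
      using calculation fin by simp
    show "\<forall>c\<in>orbit H \<phi> ` ?M. p dvd card c"
    proof clarify
      fix x h assume x: "x \<in> X" "h \<in> carrier H" "act h x \<noteq> x"
      hence "orbit H \<phi> x \<noteq> {x}" using M_orbit by blast
      hence "card (orbit H \<phi> x) \<noteq> 1"
        using self[OF x(1)] by (auto simp: card_1_singleton_iff)
      moreover have "card (orbit H \<phi> x) dvd p ^ k"
        using orbit_stabilizer_theorem[OF x(1)] ord by (metis dvd_triv_left)
      then obtain i where "card (orbit H \<phi> x) = p ^ i"
        using divides_primepow_nat[OF p] by blast
      ultimately show "p dvd card (orbit H \<phi> x)"
        by (cases i) auto
    qed
    show "\<forall>c1\<in>orbit H \<phi> ` ?M. \<forall>c2\<in>orbit H \<phi> ` ?M. c1 \<noteq> c2 \<longrightarrow> c1 \<inter> c2 = {}"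
      using eq by blast
  qed
  ultimately show ?thesis by simp
qed

corollary p_group_fixed_point:
  fixes H (structure)
  assumes "group H" and ord: "order H = p ^ k" and p: "Factorial_Ring.prime p" and fin: "finite X"
    and closed: "\<And>h x. h \<in> carrier H \<Longrightarrow> x \<in> X \<Longrightarrow> act h x \<in> X"
    and one: "\<And>x. x \<in> X \<Longrightarrow> act \<one> x = x"
    and mult: "\<And>g h x. g \<in> carrier H \<Longrightarrow> h \<in> carrier H \<Longrightarrow> x \<in> X
                 \<Longrightarrow> act (g \<otimes> h) x = act g (act h x)"
    and card: "\<not> p dvd card X"
  obtains x where "x \<in> X" "\<And>h. h \<in> carrier H \<Longrightarrow> act h x = x"
proof -
  have "p dvd card {x \<in> X. \<exists>h\<in>carrier H. act h x \<noteq> x}"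
    by (rule p_group_prime_dvd_card_moved_points[OF assms(1-4)]) (fact closed one mult)+
  with card have "{x \<in> X. \<exists>h\<in>carrier H. act h x \<noteq> x} \<noteq> X" by auto
  thus ?thesis using that by blast
qed

section \<open>Central subgroups with coprime index\<close>

text \<open>
  The complement is the kernel of the transfer \<open>V\<close> into \<open>Z\<close>. For central \<open>Z\<close> it can be described
  by a function \<open>f\<close> from the group to \<open>Z\<close> with \<open>f (z \<otimes> g) = z \<otimes> f g\<close>, which measures how far
  \<open>g\<close> is from the representative \<open>r g\<close> of its coset: \<open>V g\<close> is the product of \<open>f (t \<otimes> g)\<close> over
  the transversal \<open>T\<close>. On \<open>Z\<close> the transfer is the power map to the index of \<open>Z\<close>, which is a
  bijection as the index is prime to the order. So the kernel meets \<open>Z\<close> trivially, and every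
  element of the group differs from an element of the kernel by one of \<open>Z\<close>.
\<close>
lemma (in group) central_coprime_index_complement:
  assumes fin: "finite (carrier G)" and Z: "subgroup Z G" and cen: "Z \<subseteq> centre G"
    and cop: "coprime (card Z) (card (rcosets Z))"
  obtains K where "subgroup K G" "Z \<inter> K = {\<one>}" "Z <#> K = carrier G"
proof -
  interpret Z: subgroup Z G by (rule Z)
  have comm: "z \<otimes> g = g \<otimes> z" if "z \<in> Z" "g \<in> carrier G" for z g
    using that cen by (auto simp: centre_def)
  interpret ZG: comm_group "G\<lparr>carrier := Z\<rparr>"
    by (rule group.group_comm_groupI[OF Z.subgroup_is_group[OF group_axioms]])
       (use comm in auto)
  define r where "r g = (SOME x. x \<in> Z #> g)" for g
  have r_in: "r g \<in> Z #> g" if "g \<in> carrier G" for g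
    unfolding r_def by (rule someI[of _ g]) (rule rcos_self[OF that Z])
  have r_carr: "r g \<in> carrier G" if "g \<in> carrier G" for g
    using r_in[OF that] that by (auto simp: r_coset_def)
  have r_eq: "r g = r h \<longleftrightarrow> Z #> g = Z #> h" if "g \<in> carrier G" "h \<in> carrier G" for g h
    using r_in that repr_independence[OF _ _ Z] unfolding r_def by metis
  have r_coset: "Z #> r g = Z #> g" if "g \<in> carrier G" for g
    using r_in that repr_independence[OF _ _ Z] by metis
  define f where "f g = g \<otimes> inv (r g)" for g
  have f_Z: "f g \<in> Z" if g: "g \<in> carrier G" for g
  proof -
    obtain z where "z \<in> Z" "r g = z \<otimes> g"
      using r_in[OF g] by (auto simp: r_coset_def)
    hence "f g = inv z"
      using g by (simp add: f_def inv_mult_group inv_solve_right' flip: m_assoc)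
    thus ?thesis using \<open>z \<in> Z\<close> by simp
  qed
  have f_r: "f g \<otimes> r g = g" if "g \<in> carrier G" for g
    using that r_carr[OF that] by (simp add: f_def inv_solve_right' m_assoc)
  have f_mult: "f (z \<otimes> g) = z \<otimes> f g" if zg: "z \<in> Z" "g \<in> carrier G" for z g
  proof -
    have "z \<otimes> g \<in> Z #> g"
      using zg by (auto simp: r_coset_def)
    hence "Z #> (z \<otimes> g) = Z #> g"
      using repr_independence[OF _ zg(2) Z] by simp
    hence "r (z \<otimes> g) = r g"
      using r_eq zg by simp
    thus ?thesis
      using zg r_carr by (simp add: f_def m_assoc)
  qed
  define T where "T = r ` carrier G"
  have T_carr: "t \<in> carrier G" if "t \<in> T" for t
    using that r_carr by (auto simp: T_def)
  have finT: "finite T"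
    using fin by (simp add: T_def)
  have r_T: "r t = t" if "t \<in> T" for t
    using that r_carr r_eq r_coset by (auto simp: T_def)
  have f_T: "f t = \<one>" if "t \<in> T" for t
    using r_T[OF that] T_carr[OF that] by (simp add: f_def)
  have card_T: "card T = card (rcosets Z)"
  proof -
    have "bij_betw (\<lambda>t. Z #> t) T (rcosets Z)"
      unfolding bij_betw_def
    proof
      show "inj_on (\<lambda>t. Z #> t) T"
        using r_T r_eq T_carr by (metis inj_onI)
      show "(\<lambda>t. Z #> t) ` T = rcosets Z"
        using r_coset by (auto simp: T_def RCOSETS_def image_iff)
    qed
    thus ?thesis by (rule bij_betw_same_card)
  qed
  \<comment> \<open>Translation by \<open>g\<close> permutes the cosets of \<open>Z\<close>, hence their representatives. Reindexing
      along this permutation makes the transfer multiplicative.\<close>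
  have shift: "bij_betw (\<lambda>t. r (t \<otimes> g)) T T" if g: "g \<in> carrier G" for g
  proof -
    have "inj_on (\<lambda>t. r (t \<otimes> g)) T"
    proof (rule inj_onI)
      fix s t assume st: "s \<in> T" "t \<in> T" "r (s \<otimes> g) = r (t \<otimes> g)"
      hence "Z #> (s \<otimes> g) = Z #> (t \<otimes> g)"
        using r_eq g T_carr by simp
      hence "Z #> (s \<otimes> g) #> inv g = Z #> (t \<otimes> g) #> inv g" by simp
      hence "Z #> s = Z #> t"
        using st(1,2)[THEN T_carr] g Z.subset by (simp add: coset_mult_assoc m_assoc)
      hence "r s = r t"
        using r_eq st T_carr by simp
      thus "s = t" using r_T st by simp
    qed
    moreover have "(\<lambda>t. r (t \<otimes> g)) ` T \<subseteq> T"
      using T_carr g by (auto simp: T_def)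
    ultimately show ?thesis
      using finT by (simp add: bij_betw_def endo_inj_surj)
  qed
  define V where "V g = finprod (G\<lparr>carrier := Z\<rparr>) (\<lambda>t. f (t \<otimes> g)) T" for g
  have V_Z: "V g \<in> Z" if "g \<in> carrier G" for g
    using ZG.finprod_closed[of "\<lambda>t. f (t \<otimes> g)" T] f_Z T_carr that by (auto simp: V_def)
  have V_mult: "V (g \<otimes> h) = V g \<otimes> V h" if gh: "g \<in> carrier G" "h \<in> carrier G" for g h
  proof -
    let ?Z = "G\<lparr>carrier := Z\<rparr>"
    have "f (t \<otimes> (g \<otimes> h)) = f (t \<otimes> g) \<otimes> f (r (t \<otimes> g) \<otimes> h)" if t: "t \<in> T" for t
    proof -
      have tg: "t \<otimes> g \<in> carrier G" using t gh T_carr by simp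
      have "t \<otimes> (g \<otimes> h) = (f (t \<otimes> g) \<otimes> r (t \<otimes> g)) \<otimes> h"
        using f_r[OF tg] t gh T_carr by (simp add: m_assoc)
      also have "\<dots> = f (t \<otimes> g) \<otimes> (r (t \<otimes> g) \<otimes> h)"
        using f_Z[OF tg] r_carr[OF tg] gh by (simp add: m_assoc)
      finally show ?thesis
        using f_mult f_Z[OF tg] r_carr[OF tg] gh by simp
    qed
    hence "V (g \<otimes> h) = finprod ?Z (\<lambda>t. f (t \<otimes> g) \<otimes>\<^bsub>?Z\<^esub> f (r (t \<otimes> g) \<otimes> h)) T"
      unfolding V_def using gh T_carr f_Z r_carr
      by (intro ZG.finprod_cong') auto
    also have "\<dots> = V g \<otimes>\<^bsub>?Z\<^esub> finprod ?Z (\<lambda>t. f (r (t \<otimes> g) \<otimes> h)) T"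
      unfolding V_def using gh T_carr f_Z r_carr
      by (intro ZG.finprod_multf) auto
    also have "finprod ?Z (\<lambda>t. f (r (t \<otimes> g) \<otimes> h)) T
        = finprod ?Z (\<lambda>t. f (t \<otimes> h)) ((\<lambda>t. r (t \<otimes> g)) ` T)"
      using shift[OF gh(1)] gh T_carr f_Z r_carr
      by (intro ZG.finprod_reindex[symmetric]) (auto simp: bij_betw_def)
    also have "(\<lambda>t. r (t \<otimes> g)) ` T = T"
      using shift[OF gh(1)] by (simp add: bij_betw_def)
    finally show ?thesis by (simp add: V_def)
  qed
  have V_Zpow: "V z = z [^] card (rcosets Z)" if z: "z \<in> Z" for z
  proof -
    have "f (t \<otimes> z) = z" if "t \<in> T" for t
      using f_mult[OF z T_carr[OF that]] f_T[OF that] comm[OF z T_carr[OF that]] z by simp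
    hence "V z = finprod (G\<lparr>carrier := Z\<rparr>) (\<lambda>t. z) T"
      unfolding V_def using z by (intro ZG.finprod_cong') auto
    also have "\<dots> = z [^]\<^bsub>G\<lparr>carrier := Z\<rparr>\<^esub> card T"
      using z by (intro ZG.finprod_const) auto
    finally show ?thesis
      by (simp add: card_T nat_pow_consistent[symmetric])
  qed
  interpret V: group_hom G "G\<lparr>carrier := Z\<rparr>" V
    by (unfold_locales) (use V_Z V_mult in \<open>auto intro!: homI\<close>)
  let ?K = "kernel G (G\<lparr>carrier := Z\<rparr>) V"
  have triv: "z = \<one>" if z: "z \<in> Z" "V z = \<one>" for z
  proof -
    have "z [^] card Z = \<one>"
      using ZG.pow_order_eq_1[of z] z by (simp add: order_def nat_pow_consistent[symmetric])
    hence "ord z dvd card Z" "ord z dvd card (rcosets Z)"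
      using z V_Zpow[OF z(1)] pow_eq_id[of z] by auto
    hence "ord z = 1"
      using cop by (metis coprime_common_divisor_nat is_unit_gcd_iff nat_dvd_1_iff_1 coprime_def)
    thus ?thesis
      using z pow_eq_id[of z 1] by simp
  qed
  have sub: "subgroup ?K G" by (rule V.subgroup_kernel)
  have int: "Z \<inter> ?K = {\<one>}"
    using triv by (auto simp: kernel_def)
  have inj: "inj_on V Z"
  proof (rule inj_onI)
    fix y z assume yz: "y \<in> Z" "z \<in> Z" "V y = V z"
    have "V (y \<otimes> inv z) = \<one>"
      using yz V_mult[of y "inv z"] V_mult[of z "inv z"] V.hom_one by simp
    hence "y \<otimes> inv z = \<one>"
      using triv yz by simp
    thus "y = z"
      using yz inv_solve_right'[of \<one> y z] by simp
  qed
  have onto: "V ` Z = Z"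
    by (rule endo_inj_surj[OF subgroup_finite[OF fin Z] _ inj]) (use V_Z in auto)
  have "g \<in> Z <#> ?K" if g: "g \<in> carrier G" for g
  proof -
    obtain z where z: "z \<in> Z" "V z = V g"
      using onto V_Z[OF g] by (metis imageE)
    have "V (inv z \<otimes> g) = V (inv z) \<otimes> V g"
      by (rule V_mult) (use z g in auto)
    also have "\<dots> = V (inv z) \<otimes> V z"
      by (simp only: z(2))
    also have "\<dots> = V (inv z \<otimes> z)"
      by (rule V_mult[symmetric]) (use z in auto)
    also have "\<dots> = \<one>"
      using V.hom_one z(1) by (simp only: Z.mem_carrier l_inv) simp
    finally have "inv z \<otimes> g \<in> ?K"
      using z g by (simp add: kernel_def)
    moreover have "g = z \<otimes> (inv z \<otimes> g)"
      using z g by (simp flip: m_assoc)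
    ultimately show ?thesis
      using z by (auto simp: set_mult_def)
  qed
  hence "Z <#> ?K = carrier G"
    using setmult_subset_G[of Z ?K] Z.subset subgroup.subset[OF sub] by auto
  from that[OF sub int this] show ?thesis .
qed


section \<open>The centralizer of a Sylow subgroup\<close>

definition set_centralizer :: "('a, 'b) monoid_scheme \<Rightarrow> 'a set \<Rightarrow> 'a set" where
  "set_centralizer G A = {x \<in> carrier G. \<forall>a\<in>A. x \<otimes>\<^bsub>G\<^esub> a = a \<otimes>\<^bsub>G\<^esub> x}"

lemma (in group) subgroup_set_centralizer:
  assumes "A \<subseteq> carrier G"
  shows "subgroup (set_centralizer G A) G"
proof (rule subgroupI)
  show "set_centralizer G A \<subseteq> carrier G" by (auto simp: set_centralizer_def)
  have "\<one> \<in> set_centralizer G A"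
    using assms by (auto simp: set_centralizer_def)
  thus "set_centralizer G A \<noteq> {}" by blast
next
  fix x assume x: "x \<in> set_centralizer G A"
  have "inv x \<otimes> a = a \<otimes> inv x" if "a \<in> A" for a
  proof -
    have xa: "x \<in> carrier G" "a \<in> carrier G" "x \<otimes> a = a \<otimes> x"
      using x that assms by (auto simp: set_centralizer_def)
    have "inv x \<otimes> a = inv x \<otimes> (a \<otimes> x) \<otimes> inv x"
      using xa(1,2) by (simp add: m_assoc)
    also have "\<dots> = inv x \<otimes> (x \<otimes> a) \<otimes> inv x"
      using xa(3) by simp
    also have "\<dots> = a \<otimes> inv x"
      using xa(1,2) by (simp flip: m_assoc)
    finally show ?thesis .
  qed
  with x show "inv x \<in> set_centralizer G A" by (simp add: set_centralizer_def)
next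
  fix x y assume xy: "x \<in> set_centralizer G A" "y \<in> set_centralizer G A"
  have "x \<otimes> y \<otimes> a = a \<otimes> (x \<otimes> y)" if "a \<in> A" for a
  proof -
    have a: "x \<in> carrier G" "y \<in> carrier G" "a \<in> carrier G" "x \<otimes> a = a \<otimes> x" "y \<otimes> a = a \<otimes> y"
      using xy that assms by (auto simp: set_centralizer_def)
    have "x \<otimes> y \<otimes> a = (x \<otimes> a) \<otimes> y"
      using a(1,2,3,5) by (simp add: m_assoc)
    also have "\<dots> = a \<otimes> (x \<otimes> y)"
      unfolding a(4) using a(1-3) by (simp add: m_assoc)
    finally show ?thesis .
  qed
  with xy show "x \<otimes> y \<in> set_centralizer G A" by (simp add: set_centralizer_def)
qed

lemma (in group) inv_conjugate_conjugate:
  assumes "x \<in> carrier G" "g \<in> carrier G"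
  shows "inv x \<otimes> (x \<otimes> g \<otimes> inv x) \<otimes> x = g"
proof -
  have "inv x \<otimes> (x \<otimes> g \<otimes> inv x) \<otimes> x = inv x \<otimes> (x \<otimes> g)"
    using assms by (simp add: m_assoc)
  also have "\<dots> = g"
    using assms by (simp flip: m_assoc)
  finally show ?thesis .
qed

lemma centre_eq_set_centralizer: "centre G = set_centralizer G (carrier G)"
  by (simp add: centre_def set_centralizer_def)

lemma centralizer_eq_set_centralizer: "centralizer G g = set_centralizer G {g}"
  by (simp add: centralizer_def set_centralizer_def)

locale sylow_subgroup = group G for G (structure) +
  fixes p :: nat and P :: "'a set"
  assumes finite_carrier: "finite (carrier G)"
    and prime_p: "Factorial_Ring.prime p"
    and subgroup_P: "subgroup P G"
    and card_P: "card P = p_part p (order G)"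
begin

abbreviation D where "D \<equiv> set_centralizer G P"

abbreviation q where "q \<equiv> p'_part p (order G)"

interpretation P: subgroup P G by (rule subgroup_P)

interpretation D: subgroup D G
  by (rule subgroup_set_centralizer[OF P.subset])

interpretation Z: subgroup "centre G" G
  unfolding centre_eq_set_centralizer by (rule subgroup_set_centralizer) simp

interpretation ZP: subgroup "centre G \<inter> P" G
  by (rule subgroups_Inter_pair[OF Z.subgroup_axioms P.subgroup_axioms])

lemma D_commute: "u \<in> P \<Longrightarrow> d \<in> D \<Longrightarrow> u \<otimes> d = d \<otimes> u"
  unfolding set_centralizer_def by (blast intro: sym)

lemma Z_commute: "z \<in> centre G \<Longrightarrow> x \<in> carrier G \<Longrightarrow> z \<otimes> x = x \<otimes> z"
  unfolding centre_def by blast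

lemma centre_subset_D: "centre G \<subseteq> D"
  unfolding centre_def set_centralizer_def using P.subset by blast

lemma order_eq: "card P * q = order G"
  by (simp add: card_P p_part_mult_p'_part)

lemma order_pos: "order G > 0"
  using order_gt_0_iff_finite finite_carrier by simp

lemma p_not_dvd_q: "\<not> p dvd q"
proof
  assume "p dvd q"
  hence "is_unit p"
    by (rule coprime_common_divisor[OF coprime_p'_part[OF prime_p order_pos] _ dvd_refl])
  thus False
    using prime_p not_prime_unit by metis
qed

lemma card_subgroup_of_P:
  assumes "subgroup T G" "T \<subseteq> P"
  obtains i where "card T = p ^ i"
proof -
  have "card T dvd p ^ multiplicity p (order G)"
    using card_subgroup_dvd[OF finite_carrier assms(1) subgroup_P assms(2)]
    by (simp add: card_P p_part_def)
  thus ?thesis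
    using divides_primepow_nat[OF prime_p] that by blast
qed

lemma subgroup_PD: "subgroup (P <#> D) G"
  by (rule subgroup_set_mult_commuting[OF subgroup_P D.subgroup_axioms D_commute])

lemma index_PD: "card (rcosets (P <#> D)) * card D = q * card (P \<inter> D)"
proof -
  let ?m = "card (rcosets (P <#> D))"
  have "card P > 0"
    by (rule P.finite_imp_card_positive[OF finite_carrier])
  have "card P * (?m * card D) = ?m * (card (P <#> D) * card (P \<inter> D))"
    unfolding card_set_mult[OF finite_carrier subgroup_P D.subgroup_axioms]
    by (rule mult.left_commute)
  also have "\<dots> = order G * card (P \<inter> D)"
    by (simp add: lagrange[OF subgroup_PD] flip: mult.assoc)
  also have "\<dots> = card P * (q * card (P \<inter> D))"
    unfolding mult.assoc[symmetric] order_eq ..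
  finally show ?thesis using \<open>card P > 0\<close> by simp
qed

text \<open>
  The centre \<open>Z(G)\<close> centralizes \<open>P\<close>, so \<open>P Z(G)\<close> is a subgroup. Its index over \<open>P\<close>, which is the
  index of \<open>Z(G) \<inter> P\<close> in \<open>Z(G)\<close>, divides \<open>q\<close> and is prime to \<open>p\<close>.
\<close>
lemma p_part_card_centre: "p_part p (card (centre G)) = card (centre G \<inter> P)"
proof -
  let ?Z = "centre G"
  obtain t where t: "card ?Z = card (?Z \<inter> P) * t"
    using card_subgroup_dvd[OF finite_carrier ZP.subgroup_axioms Z.subgroup_axioms]
    unfolding dvd_def by blast
  obtain i where i: "card (?Z \<inter> P) = p ^ i"
    using card_subgroup_of_P[OF ZP.subgroup_axioms] by blast
  have pos: "card (?Z \<inter> P) > 0" "card P > 0"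
    using ZP.finite_imp_card_positive P.finite_imp_card_positive finite_carrier by auto
  have "subgroup (P <#> ?Z) G"
    by (rule subgroup_set_mult_commuting[OF subgroup_P Z.subgroup_axioms]) (use Z_commute in force)
  hence "card (P <#> ?Z) dvd order G"
    using lagrange by (metis dvd_triv_right)
  moreover have "card (P <#> ?Z) * card (?Z \<inter> P) = card P * t * card (?Z \<inter> P)"
    using card_set_mult[OF finite_carrier subgroup_P Z.subgroup_axioms] t
    by (simp add: Int_commute mult_ac)
  ultimately have "card P * t dvd card P * q"
    using pos order_eq by simp
  hence "t dvd q"
    using pos by simp
  hence "\<not> p dvd t"
    using p_not_dvd_q dvd_trans by blast
  hence "multiplicity p (card ?Z) = i"
    unfolding t i using prime_p
    by (intro multiplicity_eqI) (auto simp: dvd_mult_cancel_left not_prime_0 prime_gt_0_nat)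
  thus ?thesis by (simp add: p_part_def i)
qed

section \<open>Elements whose class size is prime to \<open>p\<close>\<close>

lemma S_p'_subset_carrier: "S_p' p G \<subseteq> carrier G"
  using S_p'_eq[OF prime_p] by auto

lemma S_p'_conjugate:
  assumes g: "g \<in> S_p' p G" and x: "x \<in> carrier G"
  shows "x \<otimes> g \<otimes> inv x \<in> S_p' p G"
proof -
  obtain a y where a: "a \<in> carrier G" "coprime (card (conjugacy_class G a)) p"
    "y \<in> carrier G" "g = y \<otimes> a \<otimes> inv y"
    using g by (auto simp: S_p'_def conjugacy_class_def)
  hence "x \<otimes> g \<otimes> inv x = (x \<otimes> y) \<otimes> a \<otimes> inv (x \<otimes> y)"
    using x by (simp add: inv_mult_group m_assoc)
  hence "x \<otimes> g \<otimes> inv x \<in> conjugacy_class G a"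
    using a x unfolding conjugacy_class_def by blast
  thus ?thesis
    using a unfolding S_p'_def by blast
qed

lemma S_p'_central_mult:
  assumes g: "g \<in> S_p' p G" and z: "z \<in> centre G"
  shows "z \<otimes> g \<in> S_p' p G"
proof -
  have g': "g \<in> carrier G" using g S_p'_subset_carrier by blast
  have "x \<otimes> (z \<otimes> g) = z \<otimes> g \<otimes> x \<longleftrightarrow> x \<otimes> g = g \<otimes> x" if x: "x \<in> carrier G" for x
  proof -
    have "x \<otimes> (z \<otimes> g) = z \<otimes> (x \<otimes> g)"
      using x g' z Z_commute[OF z x] by (simp flip: m_assoc)
    thus ?thesis
      using x g' z by (simp add: m_assoc)
  qed
  hence "centralizer G (z \<otimes> g) = centralizer G g"
    by (simp only: centralizer_def cong: conj_cong)
  thus ?thesis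
    using g g' z by (simp add: S_p'_eq[OF prime_p])
qed

lemma p_not_dvd_card_conjugacy_class:
  assumes "g \<in> S_p' p G"
  shows "\<not> p dvd card (conjugacy_class G g)"
  using assms S_p'_eq[OF prime_p] card_conjugacy_class by auto

lemma D_subset_S_p': "D \<subseteq> S_p' p G"
proof
  fix d assume d: "d \<in> D"
  have sub: "subgroup (centralizer G d) G"
    unfolding centralizer_eq_set_centralizer using d by (intro subgroup_set_centralizer) auto
  have "P \<subseteq> centralizer G d"
    unfolding centralizer_def using d D_commute P.subset by blast
  then obtain t where t: "card (centralizer G d) = card P * t"
    using card_subgroup_dvd[OF finite_carrier subgroup_P sub] unfolding dvd_def by blast
  have "card P > 0"
    by (rule P.finite_imp_card_positive[OF finite_carrier])
  moreover have "card P * (card (rcosets (centralizer G d)) * t) = card P * q"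
    using lagrange[OF sub] t order_eq by (simp add: mult_ac)
  ultimately have "card (rcosets (centralizer G d)) dvd q"
    by (metis dvd_triv_left mult_left_cancel neq0_conv)
  hence "\<not> p dvd card (rcosets (centralizer G d))"
    using p_not_dvd_q dvd_trans by blast
  thus "d \<in> S_p' p G"
    using d by (simp add: S_p'_eq[OF prime_p])
qed

lemma finite_conjugacy_class: "finite (conjugacy_class G g)"
proof -
  have "conjugacy_class G g = (\<lambda>x. x \<otimes> g \<otimes> inv x) ` carrier G"
    by (auto simp: conjugacy_class_def)
  thus ?thesis using finite_carrier by simp
qed

text \<open>
  A fixed point of \<open>P\<close> on the conjugacy class of \<open>g\<close> is a conjugate of \<open>g\<close> that commutes with \<open>P\<close>.
\<close>
lemma S_p'_conjugate_into_D:
  assumes g: "g \<in> S_p' p G"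
  obtains x d where "x \<in> carrier G" "d \<in> D" "g = inv x \<otimes> d \<otimes> x"
proof -
  have g': "g \<in> carrier G" using g S_p'_subset_carrier by blast
  let ?H = "G\<lparr>carrier := P\<rparr>"
  obtain k where k: "order ?H = p ^ k"
    using card_subgroup_of_P[OF subgroup_P] by (auto simp: order_def)
  obtain h where h: "h \<in> conjugacy_class G g"
      "\<And>u. u \<in> carrier ?H \<Longrightarrow> u \<otimes> h \<otimes> inv u = h"
  proof (rule p_group_fixed_point[where H = ?H and X = "conjugacy_class G g"
        and act = "\<lambda>u h. u \<otimes> h \<otimes> inv u", OF subgroup_imp_group[OF subgroup_P] k prime_p
        finite_conjugacy_class])
    show "u \<otimes> h \<otimes> inv u \<in> conjugacy_class G g"
      if uh: "u \<in> carrier ?H" "h \<in> conjugacy_class G g" for u h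
    proof -
      obtain x where x: "x \<in> carrier G" "h = x \<otimes> g \<otimes> inv x"
        using uh by (auto simp: conjugacy_class_def)
      hence "u \<otimes> h \<otimes> inv u = (u \<otimes> x) \<otimes> g \<otimes> inv (u \<otimes> x)"
        using uh g' by (simp add: inv_mult_group m_assoc)
      thus ?thesis
        using x uh unfolding conjugacy_class_def by auto
    qed
    show "\<one>\<^bsub>?H\<^esub> \<otimes> h \<otimes> inv \<one>\<^bsub>?H\<^esub> = h" if "h \<in> conjugacy_class G g" for h
      using that g' by (auto simp: conjugacy_class_def)
    show "(u \<otimes>\<^bsub>?H\<^esub> v) \<otimes> h \<otimes> inv (u \<otimes>\<^bsub>?H\<^esub> v) = u \<otimes> (v \<otimes> h \<otimes> inv v) \<otimes> inv u"
      if "u \<in> carrier ?H" "v \<in> carrier ?H" "h \<in> conjugacy_class G g" for u v h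
      using that g' by (auto simp: conjugacy_class_def inv_mult_group m_assoc)
    show "\<not> p dvd card (conjugacy_class G g)"
      by (rule p_not_dvd_card_conjugacy_class[OF g])
  qed blast
  obtain x where x: "x \<in> carrier G" "h = x \<otimes> g \<otimes> inv x"
    using h(1) by (auto simp: conjugacy_class_def)
  have "h \<otimes> u = u \<otimes> h" if "u \<in> P" for u
    using h(2)[of u] that x g' inv_solve_right'[of h "u \<otimes> h" u] by simp
  moreover have "h \<in> carrier G"
    using x g' by simp
  ultimately have "h \<in> D"
    unfolding set_centralizer_def by blast
  moreover have "g = inv x \<otimes> h \<otimes> x"
    using inv_conjugate_conjugate[OF x(1) g'] x(2) by simp
  ultimately show ?thesis
    using that x by blast
qed

text \<open>
  The conjugate of \<open>D\<close> by \<open>x\<close> only depends on the coset of \<open>P D\<close> containing \<open>x\<close>. Every conjugate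
  contributes at most \<open>|D| - 1\<close> nontrivial elements, and it is the shared identity that will
  force \<open>P D\<close> to have index one when \<open>S_p'\<close> is as large as possible.
\<close>
lemma card_S_p'_le:
  "card (S_p' p G) + card (rcosets (P <#> D)) \<le> card (rcosets (P <#> D)) * card D + 1"
proof -
  \<comment> \<open>the nontrivial elements of the conjugate of \<open>D\<close> that belongs to the coset \<open>C\<close>\<close>
  define F where "F C = {inv x \<otimes> d \<otimes> x | x d. x \<in> C \<and> d \<in> D} - {\<one>}" for C
  let ?R = "rcosets (P <#> D)"
  have cardD: "card D > 0" "finite D"
    using D.finite_imp_card_positive[OF finite_carrier] subgroup_finite[OF finite_carrier]
      D.subgroup_axioms by auto
  have F: "finite (F C) \<and> card (F C) \<le> card D - 1" if C: "C \<in> ?R" for C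
  proof -
    obtain a where a: "a \<in> carrier G" "C = (P <#> D) #> a"
      using C by (auto simp: RCOSETS_def)
    have "F C \<subseteq> (\<lambda>d. inv a \<otimes> d \<otimes> a) ` (D - {\<one>})"
    proof
      fix y assume y: "y \<in> F C"
      then obtain x d where xd: "x \<in> C" "d \<in> D" "y = inv x \<otimes> d \<otimes> x" "y \<noteq> \<one>"
        by (auto simp: F_def)
      obtain u e where ue: "u \<in> P" "e \<in> D" "x = u \<otimes> e \<otimes> a"
        using xd(1) a(2) by (auto simp: r_coset_def set_mult_def)
      have "inv u \<otimes> d \<otimes> u = inv u \<otimes> (u \<otimes> d)"
        using ue(1) xd(2) by (simp add: m_assoc D_commute[OF ue(1) xd(2)])
      hence "inv u \<otimes> d \<otimes> u = d"
        using ue(1) xd(2) by (simp flip: m_assoc)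
      moreover have "y = inv a \<otimes> (inv e \<otimes> (inv u \<otimes> d \<otimes> u) \<otimes> e) \<otimes> a"
        unfolding xd(3) ue(3) using ue(1,2) xd(2) a(1) by (simp add: inv_mult_group m_assoc)
      ultimately have "y = inv a \<otimes> (inv e \<otimes> d \<otimes> e) \<otimes> a"
        by (simp only:)
      moreover have "inv e \<otimes> d \<otimes> e \<in> D"
        using ue xd by simp
      moreover have "inv e \<otimes> d \<otimes> e \<noteq> \<one>"
        using calculation xd(4) a by auto
      ultimately show "y \<in> (\<lambda>d. inv a \<otimes> d \<otimes> a) ` (D - {\<one>})" by blast
    qed
    moreover have "card ((\<lambda>d. inv a \<otimes> d \<otimes> a) ` (D - {\<one>})) \<le> card D - 1"
      using card_image_le[of "D - {\<one>}" "\<lambda>d. inv a \<otimes> d \<otimes> a"] cardD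
      by (simp add: card_Diff_singleton)
    moreover have "finite ((\<lambda>d. inv a \<otimes> d \<otimes> a) ` (D - {\<one>}))"
      using cardD by simp
    ultimately show ?thesis
      using card_mono finite_subset le_trans by metis
  qed
  have finR: "finite ?R"
    using finite_carrier by (simp add: RCOSETS_def)
  have "S_p' p G \<subseteq> insert \<one> (\<Union>C\<in>?R. F C)"
  proof
    fix g assume g: "g \<in> S_p' p G"
    obtain x d where "x \<in> carrier G" "d \<in> D" "g = inv x \<otimes> d \<otimes> x"
      using S_p'_conjugate_into_D[OF g] .
    thus "g \<in> insert \<one> (\<Union>C\<in>?R. F C)"
      using rcos_self[OF _ subgroup_PD, of x] unfolding F_def RCOSETS_def by blast
  qed
  hence "card (S_p' p G) \<le> card (insert \<one> (\<Union>C\<in>?R. F C))"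
    using F finR by (intro card_mono) auto
  also have "\<dots> \<le> Suc (card (\<Union>C\<in>?R. F C))"
    by (rule card_insert_le_m1) auto
  also have "\<dots> \<le> Suc (\<Sum>C\<in>?R. card (F C))"
    using card_UN_le[OF finR] by simp
  also have "\<dots> \<le> Suc (card ?R * (card D - 1))"
    using sum_bounded_above[of ?R "\<lambda>C. card (F C)" "card D - 1"] F by simp
  finally show ?thesis
    using cardD(1) by (cases "card D") auto
qed

text \<open>
  The central \<open>p\<close>-elements \<open>t\<close> for which \<open>t \<otimes> g\<close> is conjugate to \<open>g\<close> form a \<open>p\<close>-group that acts
  on the class of \<open>g\<close> by multiplication. The class has size prime to \<open>p\<close>, so there is a fixed
  point, but only the identity fixes anything under multiplication.
\<close>
lemma central_translation_not_conjugate: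
  assumes g: "g \<in> S_p' p G" and z: "z \<in> centre G \<inter> P" and zg: "z \<otimes> g \<in> conjugacy_class G g"
  shows "z = \<one>"
proof -
  have g': "g \<in> carrier G" using g S_p'_subset_carrier by blast
  define T where "T = {z \<in> centre G \<inter> P. z \<otimes> g \<in> conjugacy_class G g}"
  have closed: "t \<otimes> h \<in> conjugacy_class G g" if th: "t \<in> T" "h \<in> conjugacy_class G g" for t h
  proof -
    obtain x y where xy: "x \<in> carrier G" "h = x \<otimes> g \<otimes> inv x"
      "y \<in> carrier G" "t \<otimes> g = y \<otimes> g \<otimes> inv y"
      using th by (auto simp: conjugacy_class_def T_def)
    have t: "t \<in> carrier G" "t \<in> centre G" using th by (auto simp: T_def)
    have "t \<otimes> h = (t \<otimes> x) \<otimes> g \<otimes> inv x"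
      using xy(1) t g' by (simp add: xy(2) m_assoc)
    also have "\<dots> = x \<otimes> (t \<otimes> g) \<otimes> inv x"
      unfolding Z_commute[OF t(2) xy(1)] using xy(1) t g' by (simp add: m_assoc)
    also have "\<dots> = x \<otimes> (y \<otimes> g \<otimes> inv y) \<otimes> inv x"
      by (simp only: xy(4))
    also have "\<dots> = (x \<otimes> y) \<otimes> g \<otimes> inv (x \<otimes> y)"
      using xy(1,3) g' by (simp add: inv_mult_group m_assoc)
    finally show ?thesis
      using xy unfolding conjugacy_class_def by auto
  qed
  have T: "subgroup T G"
  proof (rule subgroupI)
    show "T \<subseteq> carrier G" by (auto simp: T_def)
    have "\<one> \<in> T"
      using g' by (auto simp: T_def conjugacy_class_def intro!: exI[of _ \<one>])
    thus "T \<noteq> {}" by blast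
  next
    fix t assume t: "t \<in> T"
    hence t': "t \<in> carrier G" "t \<in> centre G" "t \<in> P" by (auto simp: T_def)
    obtain y where y: "y \<in> carrier G" "t \<otimes> g = y \<otimes> g \<otimes> inv y"
      using t by (auto simp: T_def conjugacy_class_def)
    have c: "inv t \<in> centre G" using t' by simp
    have "g = inv y \<otimes> (t \<otimes> g) \<otimes> y"
      using inv_conjugate_conjugate[OF y(1) g'] y(2) by simp
    also have "\<dots> = (inv y \<otimes> t) \<otimes> g \<otimes> y"
      using y(1) t'(1) g' by (simp add: m_assoc)
    also have "\<dots> = t \<otimes> (inv y \<otimes> g \<otimes> inv (inv y))"
      unfolding Z_commute[OF t'(2) inv_closed[OF y(1)], symmetric]
      using y(1) t'(1) g' by (simp add: m_assoc)
    finally have "inv y \<otimes> g \<otimes> inv (inv y) = inv t \<otimes> g"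
      using y(1) t'(1) g' inv_solve_left[of "inv y \<otimes> g \<otimes> inv (inv y)" t g] by blast
    hence "inv t \<otimes> g = inv y \<otimes> g \<otimes> inv (inv y)" ..
    hence "inv t \<otimes> g \<in> conjugacy_class G g"
      using y unfolding conjugacy_class_def by blast
    thus "inv t \<in> T"
      using c t' by (simp add: T_def)
  next
    fix s t assume st: "s \<in> T" "t \<in> T"
    hence "t \<otimes> g \<in> conjugacy_class G g" by (simp add: T_def)
    hence "s \<otimes> (t \<otimes> g) \<in> conjugacy_class G g"
      by (rule closed[OF st(1)])
    thus "s \<otimes> t \<in> T"
      using st g' by (simp add: T_def m_assoc)
  qed
  let ?H = "G\<lparr>carrier := T\<rparr>"
  obtain k where k: "order ?H = p ^ k"
    using card_subgroup_of_P[OF T] by (auto simp: order_def T_def)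
  obtain h where h: "h \<in> conjugacy_class G g" "\<And>t. t \<in> carrier ?H \<Longrightarrow> t \<otimes> h = h"
  proof (rule p_group_fixed_point[where H = ?H and X = "conjugacy_class G g"
        and act = "\<lambda>t h. t \<otimes> h", OF subgroup_imp_group[OF T] k prime_p finite_conjugacy_class])
    show "t \<otimes> h \<in> conjugacy_class G g"
      if "t \<in> carrier ?H" "h \<in> conjugacy_class G g" for t h
      using closed that by simp
    show "\<one>\<^bsub>?H\<^esub> \<otimes> h = h" if "h \<in> conjugacy_class G g" for h
      using that g' by (auto simp: conjugacy_class_def)
    show "(s \<otimes>\<^bsub>?H\<^esub> t) \<otimes> h = s \<otimes> (t \<otimes> h)"
      if "s \<in> carrier ?H" "t \<in> carrier ?H" "h \<in> conjugacy_class G g" for s t h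
      using that g' subgroup.mem_carrier[OF T] by (auto simp: conjugacy_class_def m_assoc)
    show "\<not> p dvd card (conjugacy_class G g)"
      by (rule p_not_dvd_card_conjugacy_class[OF g])
  qed blast
  have "z \<otimes> h = h"
    by (rule h(2)) (use z zg in \<open>simp add: T_def\<close>)
  moreover have "h \<in> carrier G"
    using h(1) g' by (auto simp: conjugacy_class_def)
  ultimately show ?thesis
    using z by simp
qed

section \<open>The extremal case\<close>

text \<open>
  Here the action of \<open>P\<close> on the cosets of \<open>centre G \<inter> P\<close> in \<open>S_p'\<close> is used. If the coset of \<open>g\<close> is
  fixed, then each \<open>u\<close> in \<open>P\<close> conjugates \<open>g\<close> to a central translate of \<open>g\<close>, and by
  \<open>central_translation_not_conjugate\<close> this translate is \<open>g\<close> itself.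
\<close>
lemma centre_of_P_central:
  assumes eq: "card (S_p' p G) = q * card (centre G \<inter> P)"
  shows "P \<inter> D = centre G \<inter> P"
proof -
  let ?S = "S_p' p G" and ?Z = "centre G \<inter> P" and ?H = "G\<lparr>carrier := P\<rparr>"
  define X where "X = (\<lambda>g. ?Z #> g) ` ?S"
  define act where "act u C = (\<lambda>x. u \<otimes> x \<otimes> inv u) ` C" for u C
  define moved where "moved = {C \<in> X. \<exists>u\<in>P. act u C \<noteq> C}"
  have S_carr: "g \<in> carrier G" if "g \<in> ?S" for g
    using that S_p'_subset_carrier by blast
  have posZ: "card ?Z > 0"
    by (rule ZP.finite_imp_card_positive[OF finite_carrier])
  have finX: "finite X"
    using finite_subset[OF S_p'_subset_carrier finite_carrier] by (simp add: X_def)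
  have "card X * card ?Z = card ?S"
    unfolding X_def
    by (rule card_cosets_of_invariant_set[OF finite_carrier ZP.subgroup_axioms S_p'_subset_carrier])
       (auto intro: S_p'_central_mult)
  hence cardX: "card X = q"
    using eq posZ by simp
  have act_coset: "act u (?Z #> g) = ?Z #> (u \<otimes> g \<otimes> inv u)"
    if ug: "u \<in> carrier G" "g \<in> carrier G" for u g
  proof -
    have "u \<otimes> (z \<otimes> g) \<otimes> inv u = z \<otimes> (u \<otimes> g \<otimes> inv u)" if z: "z \<in> ?Z" for z
    proof -
      have "u \<otimes> (z \<otimes> g) \<otimes> inv u = (u \<otimes> z) \<otimes> g \<otimes> inv u"
        using ug z by (simp add: m_assoc)
      also have "\<dots> = (z \<otimes> u) \<otimes> g \<otimes> inv u"
        using Z_commute[of z u] ug z by simp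
      also have "\<dots> = z \<otimes> (u \<otimes> g \<otimes> inv u)"
        using ug z by (simp add: m_assoc)
      finally show ?thesis .
    qed
    thus ?thesis
      unfolding act_def r_coset_def by (auto simp: image_UN)
  qed
  have "p dvd card {C \<in> X. \<exists>u\<in>carrier ?H. act u C \<noteq> C}"
  proof (rule p_group_prime_dvd_card_moved_points[OF subgroup_imp_group[OF subgroup_P] _ prime_p finX])
    show "order ?H = p ^ multiplicity p (order G)"
      using card_P by (simp add: order_def p_part_def)
    show "act u C \<in> X" if uC: "u \<in> carrier ?H" "C \<in> X" for u C
    proof -
      obtain g where g: "g \<in> ?S" "C = ?Z #> g"
        using uC by (auto simp: X_def)
      have u: "u \<in> carrier G" using uC by simp
      show ?thesis
        unfolding g(2) act_coset[OF u S_carr[OF g(1)]] X_def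
        using S_p'_conjugate[OF g(1) u] by blast
    qed
    show "act \<one>\<^bsub>?H\<^esub> C = C" if C: "C \<in> X" for C
    proof -
      obtain g where g: "g \<in> ?S" "C = ?Z #> g"
        using C by (auto simp: X_def)
      show ?thesis
        using act_coset[OF one_closed S_carr[OF g(1)]] g S_carr by simp
    qed
    show "act (u \<otimes>\<^bsub>?H\<^esub> v) C = act u (act v C)"
      if uvC: "u \<in> carrier ?H" "v \<in> carrier ?H" "C \<in> X" for u v C
    proof -
      obtain g where g: "g \<in> ?S" "C = ?Z #> g"
        using uvC by (auto simp: X_def)
      have uv: "u \<in> carrier G" "v \<in> carrier G" using uvC by simp_all
      show ?thesis
        using uv S_carr[OF g(1)]
        by (simp add: g(2) act_coset inv_mult_group m_assoc)
    qed
  qed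
  hence p_moved: "p dvd card moved"
    by (simp add: moved_def)
  have fixed: "X - moved = (\<lambda>g. ?Z #> g) ` D"
  proof (rule equalityI; rule subsetI)
    fix C assume C: "C \<in> X - moved"
    then obtain g where g: "g \<in> ?S" "C = ?Z #> g"
      by (auto simp: X_def)
    note g' = S_carr[OF g(1)]
    have "g \<otimes> u = u \<otimes> g" if u: "u \<in> P" for u
    proof -
      have u': "u \<in> carrier G" using u by simp
      have "act u C = C"
        using C u by (auto simp: moved_def)
      hence "?Z #> (u \<otimes> g \<otimes> inv u) = ?Z #> g"
        using act_coset[OF u' g'] g(2) by simp
      hence "u \<otimes> g \<otimes> inv u \<in> ?Z #> g"
        using rcos_self[OF _ ZP.subgroup_axioms, of "u \<otimes> g \<otimes> inv u"] u' g' by simp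
      then obtain z where z: "z \<in> ?Z" "u \<otimes> g \<otimes> inv u = z \<otimes> g"
        by (auto simp: r_coset_def)
      hence "z \<otimes> g \<in> conjugacy_class G g"
        using u' unfolding conjugacy_class_def by force
      hence "z = \<one>"
        by (rule central_translation_not_conjugate[OF g(1) z(1)])
      hence "u \<otimes> g \<otimes> inv u = g"
        using z(2) g' by simp
      thus ?thesis
        using inv_solve_right'[of g "u \<otimes> g" u] u' g' by simp
    qed
    hence "g \<in> D"
      using g' unfolding set_centralizer_def by blast
    thus "C \<in> (\<lambda>g. ?Z #> g) ` D"
      using g(2) by blast
  next
    fix C assume "C \<in> (\<lambda>g. ?Z #> g) ` D"
    then obtain d where d: "d \<in> D" "C = ?Z #> d" by blast
    have "act u C = C" if u: "u \<in> P" for u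
    proof -
      have "u \<otimes> d \<otimes> inv u = d \<otimes> u \<otimes> inv u"
        by (simp only: D_commute[OF u d(1)])
      also have "\<dots> = d"
        using u d(1) by (simp add: m_assoc)
      finally show ?thesis
        using act_coset[of u d] u d by simp
    qed
    moreover have "C \<in> X"
      using d D_subset_S_p' by (auto simp: X_def)
    ultimately show "C \<in> X - moved"
      by (simp add: moved_def)
  qed
  have "card (X - moved) * card ?Z = card D"
    unfolding fixed
    by (rule card_cosets_of_invariant_set[OF finite_carrier ZP.subgroup_axioms D.subset])
       (use centre_subset_D in blast)
  \<comment> \<open>The index of \<open>centre G \<inter> P\<close> in \<open>P \<inter> D\<close> is a power of \<open>p\<close> and divides the number of fixed
      cosets, which is congruent to \<open>q\<close> modulo \<open>p\<close>; so this index is one.\<close>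
  moreover obtain r where r: "card D = card (P \<inter> D) * r"
    using card_subgroup_dvd[OF finite_carrier
        subgroups_Inter_pair[OF subgroup_P D.subgroup_axioms] D.subgroup_axioms]
    unfolding dvd_def by blast
  moreover obtain s where s: "card (P \<inter> D) = card ?Z * s"
    using card_subgroup_dvd[OF finite_carrier ZP.subgroup_axioms
        subgroups_Inter_pair[OF subgroup_P D.subgroup_axioms]] centre_subset_D
    unfolding dvd_def by blast
  ultimately have "card (X - moved) * card ?Z = (s * r) * card ?Z"
    by (simp add: mult_ac)
  hence "card (X - moved) = s * r"
    using posZ by simp
  moreover have "card X = card (X - moved) + card moved"
    using finX card_Diff_subset[of moved X] card_mono[of X moved]
    by (auto simp: moved_def)
  ultimately have "q = s * r + card moved"
    using cardX by simp
  hence "\<not> p dvd s"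
    using p_not_dvd_q p_moved by auto
  moreover obtain i where "card (P \<inter> D) = p ^ i"
    using card_subgroup_of_P[OF subgroups_Inter_pair[OF subgroup_P D.subgroup_axioms]] by blast
  hence "s dvd p ^ i"
    using s by (metis dvd_triv_right)
  then obtain j where "s = p ^ j"
    using divides_primepow_nat[OF prime_p] by blast
  ultimately have "s = 1"
    by (cases j) auto
  hence "card ?Z = card (P \<inter> D)"
    using s by simp
  moreover have "finite (P \<inter> D)"
    using finite_carrier P.subset finite_subset by blast
  moreover have "?Z \<subseteq> P \<inter> D"
    using centre_subset_D by blast
  ultimately show ?thesis
    using card_subset_eq by metis
qed

lemma index_PD_full:
  assumes "P <#> D = carrier G"
  shows "card (rcosets (P <#> D)) = 1"
proof -
  have "card (rcosets (P <#> D)) * order G = order G"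
    using lagrange[OF subgroup_PD] assms by (simp add: order_def)
  thus ?thesis
    using order_pos by simp
qed

text \<open>
  The left side makes \<open>P \<inter> D\<close> central, so that \<open>S_p'\<close> has \<open>m |D|\<close> elements, where \<open>m\<close> is the index
  of \<open>P D\<close>; the bound \<open>m |D| - m + 1\<close> on this number only allows \<open>m = 1\<close>. If \<open>G = P D\<close>, then the
  same bound gives \<open>S_p' = D\<close>.
\<close>
theorem card_S_p'_eq_iff:
  "card (S_p' p G) = q * p_part p (card (centre G)) \<longleftrightarrow> P <#> D = carrier G"
proof
  let ?m = "card (rcosets (P <#> D))"
  assume "card (S_p' p G) = q * p_part p (card (centre G))"
  hence eq: "card (S_p' p G) = q * card (centre G \<inter> P)"
    by (simp only: p_part_card_centre)
  have "?m * card D = card (S_p' p G)"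
    using index_PD centre_of_P_central[OF eq] eq by simp
  hence "?m \<le> 1"
    using card_S_p'_le by linarith
  moreover have "?m * card (P <#> D) = order G"
    by (rule lagrange[OF subgroup_PD])
  ultimately have "card (P <#> D) = card (carrier G)"
    using order_pos by (cases ?m) (auto simp: order_def)
  thus "P <#> D = carrier G"
    using card_subset_eq[OF finite_carrier subgroup.subset[OF subgroup_PD]] by simp
next
  assume PD: "P <#> D = carrier G"
  note m = index_PD_full[OF PD]
  have "card (S_p' p G) \<le> card D"
    using card_S_p'_le unfolding m by simp
  moreover have "card D \<le> card (S_p' p G)"
    using card_mono[OF finite_subset[OF S_p'_subset_carrier finite_carrier] D_subset_S_p'] .
  moreover have "P \<inter> D = centre G \<inter> P"
  proof (rule equalityI; rule subsetI)
    fix y assume y: "y \<in> P \<inter> D"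
    have "y \<otimes> g = g \<otimes> y" if g: "g \<in> carrier G" for g
    proof -
      obtain u d where ud: "u \<in> P" "d \<in> D" "g = u \<otimes> d"
        using g unfolding PD[symmetric] set_mult_def by blast
      have "y \<otimes> g = (y \<otimes> u) \<otimes> d"
        using y ud by (simp add: m_assoc)
      also have "\<dots> = (u \<otimes> y) \<otimes> d"
        using D_commute[of u y] y ud(1) by simp
      also have "\<dots> = u \<otimes> (y \<otimes> d)"
        using y ud by (simp add: m_assoc)
      also have "\<dots> = u \<otimes> (d \<otimes> y)"
        using D_commute[of y d] y ud(2) by simp
      also have "\<dots> = g \<otimes> y"
        using y ud by (simp add: m_assoc)
      finally show ?thesis .
    qed
    moreover have "y \<in> carrier G" using y by simp
    ultimately have "y \<in> centre G"
      unfolding centre_def by (intro CollectI conjI ballI)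
    thus "y \<in> centre G \<inter> P" using y by simp
  qed (use centre_subset_D in blast)
  ultimately show "card (S_p' p G) = q * p_part p (card (centre G))"
    using index_PD m p_part_card_centre by simp
qed

section \<open>Splitting off the \<open>p'\<close>-factor\<close>

text \<open>
  A complement of \<open>P \<inter> D\<close> in \<open>D\<close> is a complement of \<open>P\<close> in \<open>P D\<close>, and it commutes with \<open>P\<close>.
  So both factors are normal in \<open>G\<close>.
\<close>
lemma complement_of_P:
  assumes PD: "P <#> D = carrier G"
  obtains Q where "internal_direct_product G P Q" "subgroup Q G" "card Q = q"
proof -
  let ?H = "G\<lparr>carrier := D\<rparr>" and ?Y = "P \<inter> D"
  interpret H: group ?H
    by (rule subgroup_imp_group[OF D.subgroup_axioms])
  have Y: "subgroup ?Y ?H"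
    by (rule subgroup_incl[OF subgroups_Inter_pair[OF subgroup_P D.subgroup_axioms]
          D.subgroup_axioms]) simp
  have finD: "finite (carrier ?H)"
    using finite_subset[OF D.subset finite_carrier] by simp
  have cen: "?Y \<subseteq> centre ?H"
    using D_commute by (auto simp: centre_def)
  have "card D = q * card ?Y"
    using index_PD index_PD_full[OF PD] by simp
  moreover have "card (rcosets\<^bsub>?H\<^esub> ?Y) * card ?Y = card D"
    using H.lagrange[OF Y] by (simp add: order_def)
  moreover have "card ?Y > 0"
    using subgroup.finite_imp_card_positive[OF Y finD] .
  ultimately have index: "card (rcosets\<^bsub>?H\<^esub> ?Y) = q" by simp
  obtain i where "card ?Y = p ^ i"
    using card_subgroup_of_P[OF subgroups_Inter_pair[OF subgroup_P D.subgroup_axioms]] by blast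
  hence "coprime (card ?Y) (card (rcosets\<^bsub>?H\<^esub> ?Y))"
    using coprime_p'_part[OF prime_p order_pos] by (simp add: index coprime_commute)
  then obtain Q where Q: "subgroup Q ?H" "?Y \<inter> Q = {\<one>\<^bsub>?H\<^esub>}" "?Y <#>\<^bsub>?H\<^esub> Q = carrier ?H"
    using H.central_coprime_index_complement[OF finD Y cen] by blast
  have QG: "subgroup Q G"
    by (rule incl_subgroup[OF D.subgroup_axioms Q(1)])
  have QD: "Q \<subseteq> D"
    using subgroup.subset[OF Q(1)] by simp
  have int: "P \<inter> Q = {\<one>}"
    using Q(2) QD by auto
  have "g \<in> P <#> Q" if g: "g \<in> carrier G" for g
  proof -
    obtain u d where ud: "u \<in> P" "d \<in> D" "g = u \<otimes> d"
      using g unfolding PD[symmetric] set_mult_def by blast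
    have "d \<in> ?Y <#>\<^bsub>?H\<^esub> Q"
      using ud(2) Q(3) by simp
    then obtain y k where yk: "y \<in> P" "k \<in> Q" "d = y \<otimes> k"
      by (auto simp: set_mult_def)
    have "g = (u \<otimes> y) \<otimes> k"
      using ud yk subgroup.mem_carrier[OF QG] by (simp add: m_assoc)
    thus ?thesis
      using ud(1) yk(1,2) P.m_closed unfolding set_mult_def by blast
  qed
  hence full: "P <#> Q = carrier G"
    using setmult_subset_G[OF P.subset subgroup.subset[OF QG]] by blast
  interpret group_disjoint_sum G P Q
    by (intro group_disjoint_sum.intro group_axioms subgroup_P QG)
  have comm: "u \<otimes> k = k \<otimes> u" if "u \<in> P" "k \<in> Q" for u k
    using that QD D_commute by blast
  have "P \<lhd> G" "Q \<lhd> G"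
    using commuting_imp_normal1[OF _ comm] commuting_imp_normal2[OF _ comm] full by auto
  hence prod: "internal_direct_product G P Q"
    using int full by (simp add: internal_direct_product_def)
  have "card P * card Q = order G"
    using card_set_mult[OF finite_carrier subgroup_P QG] full int by (simp add: order_def)
  also have "\<dots> = card P * q"
    by (rule order_eq[symmetric])
  finally have "card P * card Q = card P * q" .
  hence "card Q = q"
    using P.finite_imp_card_positive[OF finite_carrier] by simp
  with prod QG that show ?thesis by blast
qed

end

theorem theorem3p3:
  fixes G :: "('a, 'b) monoid_scheme" and p :: nat
  assumes "group G" and "finite (carrier G)" and "Factorial_Ring.prime p"
  shows "(\<exists>P Q. internal_direct_product G P Q \<and>
            p_group p (G\<lparr>carrier := P\<rparr>) \<and> p'_group p (G\<lparr>carrier := Q\<rparr>))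
         \<longleftrightarrow> card (S_p' p G) = p'_part p (order G) * p_part p (card (centre G))"
proof
  interpret group G by (rule assms(1))
  assume "\<exists>P Q. internal_direct_product G P Q \<and>
            p_group p (G\<lparr>carrier := P\<rparr>) \<and> p'_group p (G\<lparr>carrier := Q\<rparr>)"
  then obtain P Q k where PQ: "P \<lhd> G" "Q \<lhd> G" "P \<inter> Q = {\<one>\<^bsub>G\<^esub>}" "P <#>\<^bsub>G\<^esub> Q = carrier G"
      and P: "card P = p ^ k" and Q: "coprime (card Q) p"
    by (auto simp: internal_direct_product_def p_group_def p'_group_def order_def)
  have sub: "subgroup P G" "subgroup Q G"
    using PQ normal_imp_subgroup by auto
  have order: "order G = p ^ k * card Q"
    using card_set_mult[OF assms(2) sub] PQ(3,4) P by (simp add: order_def)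
  have "\<not> p dvd card Q"
  proof
    assume "p dvd card Q"
    hence "is_unit p"
      by (rule coprime_common_divisor[OF Q _ dvd_refl])
    thus False
      using assms(3) not_prime_unit by metis
  qed
  hence mult: "multiplicity p (order G) = k"
    unfolding order using assms(3) by (intro multiplicity_eqI) (auto simp: prime_gt_0_nat)
  have "card P = p_part p (order G)"
    unfolding p_part_def P mult ..
  then interpret sylow_subgroup G p P
    using assms sub(1) by (intro sylow_subgroup.intro sylow_subgroup_axioms.intro)
  have "Q \<subseteq> set_centralizer G P"
  proof
    fix y assume y: "y \<in> Q"
    hence "y \<otimes>\<^bsub>G\<^esub> x = x \<otimes>\<^bsub>G\<^esub> y" if "x \<in> P" for x
      using normal_imp_commuting[OF PQ(1,2) _ that y] PQ(3) by simp
    thus "y \<in> set_centralizer G P"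
      using subgroup.mem_carrier[OF sub(2) y] unfolding set_centralizer_def by blast
  qed
  hence "P <#>\<^bsub>G\<^esub> set_centralizer G P = carrier G"
    using mono_set_mult[of P P Q "set_centralizer G P" G] PQ(4) subgroup.subset[OF subgroup_PD]
    by auto
  thus "card (S_p' p G) = p'_part p (order G) * p_part p (card (centre G))"
    using card_S_p'_eq_iff by simp
next
  assume eq: "card (S_p' p G) = p'_part p (order G) * p_part p (card (centre G))"
  have "order G = p ^ multiplicity p (order G) * p'_part p (order G)"
    using p_part_mult_p'_part[of p "order G"] by (simp add: p_part_def)
  hence "\<exists>P. subgroup P G \<and> card P = p ^ multiplicity p (order G)"
    by (rule sylow_thm[OF assms(3,1) _ assms(2)])
  then obtain P where "subgroup P G" "card P = p ^ multiplicity p (order G)" by blast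
  then interpret sylow_subgroup G p P
    using assms by (intro sylow_subgroup.intro sylow_subgroup_axioms.intro) (auto simp: p_part_def)
  obtain Q where Q: "internal_direct_product G P Q" "subgroup Q G" "card Q = p'_part p (order G)"
    using complement_of_P eq card_S_p'_eq_iff by blast
  have "p_group p (G\<lparr>carrier := P\<rparr>)"
    using subgroup_imp_group[OF subgroup_P] subgroup_finite[OF assms(2) subgroup_P] card_P
    by (auto simp: p_group_def order_def p_part_def)
  moreover have "p'_group p (G\<lparr>carrier := Q\<rparr>)"
    using subgroup_imp_group[OF Q(2)] subgroup_finite[OF assms(2) Q(2)]
      coprime_p'_part[OF assms(3) order_pos] Q(3)
    by (simp add: p'_group_def order_def)
  ultimately show "\<exists>P Q. internal_direct_product G P Q \<and>
            p_group p (G\<lparr>carrier := P\<rparr>) \<and> p'_group p (G\<lparr>carrier := Q\<rparr>)"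
    using Q(1) by blast
qed

end
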